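(* Let $k\ge 0$ and let $f:\mathbb{D}\to\mathbb{D}$ be holomorphic and not a Blaschke product of degree at most $k$. Let $\sigma\in\partial\mathbb{D}$ with $\beta_f(\sigma)<+\infty$. Then $$\beta_f(\sigma)\ge\sum_{j=0}^k\prod_{h=0}^j\frac{1-|\Delta_{\mathbf{O}_h}f(0)|}{1+|\Delta_{\mathbf{O}_h}f(0)|},$$ where $\mathbf{O}_h=(0,\ldots,0)\in\mathbb{D}^h$ and $\Delta_{\mathbf{O}_h}f=f$ when $h=0$. Furthermore, equality holds if and only if $f$ is a Blaschke product of degree $k+1$ and $\Delta_{\mathbf{O}_h}f(0)=|\Delta_{\mathbf{O}_h}f(0)|\,\Delta_{\mathbf{O}_h}f(\sigma)$ for all $h=0,\ldots,k$.
   Context: $\mathbb{D}=\{z\in\mathbb{C}:|z|<1\}$ and $\partial\mathbb{D}$ is the unit circle. For a holomorphic $g:\mathbb{D}\to\mathbb{D}$ and $\sigma\in\partial\mathbb{D}$, the boundary dilation coefficient is $\beta_g(\sigma)=\liminf_{z\to\sigma}\frac{1-|g(z)|}{1-|z|}$. A Blaschke product of degree $d\ge 1$ is a function $B(z)=e^{i\theta}\prod_{j=1}^d\frac{z-a_j}{1-\overline{a_j}z}$ with $\theta\in\mathbb{R}$, $a_1,\ldots,a_d\in\mathbb{D}$; those of degree $0$ are the constants of modulus $1$. For $g:\mathbb{D}\to\mathbb{D}$ holomorphic and $w\in\mathbb{D}$, the hyperbolic difference quotient is the holomorphic function $\Delta_w g(z)=g^*(z,w)$, where $g^*(z,w)=\frac{g(z)-g(w)}{1-\overline{g(w)}g(z)}\big/\frac{z-w}{1-\overline{w}z}$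 for $z\ne w$ and $g^*(w,w)=g'(w)\frac{1-|w|^2}{1-|g(w)|^2}$. Inductively, $\Delta_{w_h,\ldots,w_1}f=\Delta_{w_h}(\Delta_{w_{h-1},\ldots,w_1}f)$; $\Delta_{\mathbf{O}_h}f$ is the case $w_1=\cdots=w_h=0$. If $f$ is not a Blaschke product of degree at most $k$, then for $0\le h\le k$ the function $\Delta_{\mathbf{O}_h}f$ is a well-defined holomorphic map $\mathbb{D}\to\mathbb{D}$. If $\beta_f(\sigma)<+\infty$, each of these has a non-tangential limit at $\sigma$ (limit as $z\to\sigma$ inside each region $\{z\in\mathbb{D}:|\sigma-z|<M(1-|z|)\}$, $M>1$), lying in $\partial\mathbb{D}$ and denoted $\Delta_{\mathbf{O}_h}f(\sigma)$. *)

theory Defs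
  imports "HOL-Analysis.Analysis"
begin

abbreviation unit_disc :: "complex set"
  where "unit_disc \<equiv> ball 0 1"

abbreviation unit_circle :: "complex set"
  where "unit_circle \<equiv> sphere 0 1"

(* Maps on the disc are total functions on the complex numbers; only their values on the
   open disc enter the notions below. *)

definition boundary_dilation :: "(complex \<Rightarrow> complex) \<Rightarrow> complex \<Rightarrow> ereal"
  where "boundary_dilation g \<sigma> =
    Liminf (at \<sigma> within unit_disc) (\<lambda>z. ereal ((1 - norm (g z)) / (1 - norm z)))"

(* For d = 0 the product is empty, which gives the constants of modulus 1. *)
definition blaschke_product :: "nat \<Rightarrow> (complex \<Rightarrow> complex) \<Rightarrow> bool"
  where "blaschke_product d B \<longleftrightarrow>
    (\<exists>(\<theta>::real) (a::nat \<Rightarrow> complex).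
      (\<forall>j\<in>{1..d}. a j \<in> unit_disc) \<and>
      (\<forall>z\<in>unit_disc. B z = exp (\<i> * of_real \<theta>) * (\<Prod>j=1..d. (z - a j) / (1 - cnj (a j) * z))))"

definition hyp_diff_quot :: "complex \<Rightarrow> (complex \<Rightarrow> complex) \<Rightarrow> complex \<Rightarrow> complex"
  where "hyp_diff_quot w g z =
    (if z = w
     then deriv g w * of_real ((1 - (norm w)\<^sup>2) / (1 - (norm (g w))\<^sup>2))
     else ((g z - g w) / (1 - cnj (g w) * g z)) / ((z - w) / (1 - cnj w * z)))"

(* The list is written in the order of the subscript: [w_h, ..., w_1], so w_1 acts first. *)
primrec iter_hyp_diff_quot :: "complex list \<Rightarrow> (complex \<Rightarrow> complex) \<Rightarrow> complex \<Rightarrow> complex"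
  where
    "iter_hyp_diff_quot [] f = f"
  | "iter_hyp_diff_quot (w # ws) f = hyp_diff_quot w (iter_hyp_diff_quot ws f)"

abbreviation hyp_diff_quot_zeros :: "nat \<Rightarrow> (complex \<Rightarrow> complex) \<Rightarrow> complex \<Rightarrow> complex"
  where "hyp_diff_quot_zeros h f \<equiv> iter_hyp_diff_quot (replicate h 0) f"

definition stolz_region :: "complex \<Rightarrow> real \<Rightarrow> complex set"
  where "stolz_region \<sigma> M = {z \<in> unit_disc. norm (\<sigma> - z) < M * (1 - norm z)}"

definition has_nontangential_limit :: "(complex \<Rightarrow> complex) \<Rightarrow> complex \<Rightarrow> complex \<Rightarrow> bool"
  where "has_nontangential_limit g \<sigma> l \<longleftrightarrow>
    (\<forall>M>1. (g \<longlongrightarrow> l) (at \<sigma> within stolz_region \<sigma> M))"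

definition nontangential_limit :: "(complex \<Rightarrow> complex) \<Rightarrow> complex \<Rightarrow> complex"
  where "nontangential_limit g \<sigma> = (THE l. has_nontangential_limit g \<sigma> l)"

lemma stolz_region_nontrivial:
  assumes "\<sigma> \<in> unit_circle" "M > 1"
  shows "at \<sigma> within stolz_region \<sigma> M \<noteq> bot"
proof -
  have n: "norm \<sigma> = 1" using assms(1) by simp
  have "\<exists>z\<in>stolz_region \<sigma> M. z \<noteq> \<sigma> \<and> dist z \<sigma> < e" if "e > 0" for e
  proof -
    define t where "t = min (e/2) (1/2)"
    have t: "t > 0" "t < 1" "t < e" using that by (auto simp: t_def)
    define z where "z = of_real (1 - t) * \<sigma>"
    have nz: "norm z = 1 - t" using t by (simp add: z_def norm_mult n flip: of_real_diff)
    have "\<sigma> - z = of_real t * \<sigma>" by (simp add: z_def algebra_simps)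
    hence d: "norm (\<sigma> - z) = t" using t by (simp add: norm_mult n)
    have "z \<in> stolz_region \<sigma> M" using t assms(2) by (simp add: stolz_region_def nz d)
    moreover have "z \<noteq> \<sigma>" using d t by auto
    moreover have "dist z \<sigma> < e" using d t by (simp add: dist_norm norm_minus_commute)
    ultimately show ?thesis by blast
  qed
  thus ?thesis by (simp add: trivial_limit_within islimpt_approachable)
qed

lemma nontangential_limit_eqI:
  assumes "\<sigma> \<in> unit_circle" "has_nontangential_limit g \<sigma> l"
  shows "nontangential_limit g \<sigma> = l"
  unfolding nontangential_limit_def
proof (rule the_equality)
  fix l' assume "has_nontangential_limit g \<sigma> l'"
  hence "(g \<longlongrightarrow> l') (at \<sigma> within stolz_region \<sigma> 2)"
    by (simp add: has_nontangential_limit_def)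
  moreover have "(g \<longlongrightarrow> l) (at \<sigma> within stolz_region \<sigma> 2)"
    using assms(2) by (simp add: has_nontangential_limit_def)
  ultimately show "l' = l"
    using tendsto_unique[OF stolz_region_nontrivial[OF assms(1), of 2]] by simp
qed (fact assms(2))

end

theory Submission
  imports Defs "HOL-Complex_Analysis.Riemann_Mapping"
    "HOL-Computational_Algebra.Fundamental_Theorem_Algebra"
begin

text \<open>
Let \<open>D\<^sub>h\<close> be the $h$-th difference quotient of $f$ at the origin, \<open>a\<^sub>h = D\<^sub>h 0\<close>, \<open>\<eta>\<^sub>h\<close> its nontangential
limit at \<open>\<sigma>\<close> and \<open>b\<^sub>h\<close> its boundary dilation. By definition, the Moebius map that sends \<open>a\<^sub>h\<close> to the
origin carries \<open>D\<^sub>h z\<close> to \<open>z * D\<^sub>h\<^sub>+\<^sub>1 z\<close>. The factor $z$ adds $1$ to the dilation; the Moebius map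
multiplies the dilation by the modulus of its derivative at \<open>\<eta>\<^sub>h\<close>. This gives an exact recursion
(\<open>boundary_dilation_hyp_diff_quot_0\<close>)
\<open>b\<^sub>h = (1 + b\<^sub>h\<^sub>+\<^sub>1) q\<^sub>h\<close> with \<open>q\<^sub>h = \<bar>1 - cnj a\<^sub>h * \<eta>\<^sub>h\<bar>\<^sup>2 / (1 - \<bar>a\<^sub>h\<bar>\<^sup>2)\<close>,
and unfolding it expresses \<open>b\<^sub>0\<close> as the sum over \<open>j \<le> k\<close> of the products \<open>q\<^sub>0 \<cdots> q\<^sub>j\<close>, plus the remainder
\<open>q\<^sub>0 \<cdots> q\<^sub>k * b\<^sub>k\<^sub>+\<^sub>1\<close>.

Since \<open>q\<^sub>h \<ge> (1 - \<bar>a\<^sub>h\<bar>) / (1 + \<bar>a\<^sub>h\<bar>)\<close> (\<open>dilation_factor_ge\<close>) and the remainder is nonnegative, the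
inequality follows. Equality holds exactly if each \<open>q\<^sub>h\<close> is minimal, which is the condition
\<open>a\<^sub>h = \<bar>a\<^sub>h\<bar> \<eta>\<^sub>h\<close>, and \<open>b\<^sub>k\<^sub>+\<^sub>1 = 0\<close>. A holomorphic self-map of the disc has positive dilation
(\<open>dilation_pos\<close>), so the latter says that \<open>D\<^sub>k\<^sub>+\<^sub>1\<close> is a unimodular constant. As each difference
quotient lowers the degree of a Blaschke product by exactly one (\<open>blaschke_product_Suc_iff\<close>), this
means that $f$ is a Blaschke product of degree $k+1$.

The analytic difficulty is that the dilation is a lower limit over unrestricted approach, whereas
\<open>\<eta>\<^sub>h\<close> is only a nontangential limit. Julia's inequality resolves it: along every sequence with bounded
dilation quotient, tangential or not, the values converge to \<open>\<eta>\<^sub>h\<close> (\<open>tendsto_nontangential_limit\<close>).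
The algebraic ingredient is that Moebius maps preserve Blaschke products and their degree
(\<open>blaschke_product_moebius\<close>), which is a factorization of polynomials.
\<close>

section \<open>Blaschke products under Moebius maps\<close>

text \<open>A multiset of zeros is the convenient form: the complete factorization of a complex polynomial
yields a multiset of roots, and adding or removing a zero is \<^const>\<open>add_mset\<close>.\<close>

lemma blaschke_product_iff_mset:
  "blaschke_product d B \<longleftrightarrow>
    (\<exists>c A. norm c = 1 \<and> size A = d \<and> (\<forall>x\<in>#A. norm x < 1) \<and>
      (\<forall>z\<in>unit_disc. B z = c * ((\<Prod>x\<in>#A. z - x) / (\<Prod>x\<in>#A. 1 - cnj x * z))))"
proof
  assume "blaschke_product d B"
  then obtain \<theta> :: real and a where a: "\<forall>j\<in>{1..d}. a j \<in> unit_disc"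
    and B: "\<And>z. z \<in> unit_disc \<Longrightarrow>
      B z = exp (\<i> * of_real \<theta>) * (\<Prod>j=1..d. (z - a j) / (1 - cnj (a j) * z))"
    unfolding blaschke_product_def by blast
  define A where "A = image_mset a (mset_set {1..d})"
  have "(\<Prod>j=1..d. (z - a j) / (1 - cnj (a j) * z))
      = (\<Prod>x\<in>#A. z - x) / (\<Prod>x\<in>#A. 1 - cnj x * z)" for z
    by (simp add: A_def prod_dividef prod_unfold_prod_mset image_mset.compositionality o_def)
  then show "\<exists>c A. norm c = 1 \<and> size A = d \<and> (\<forall>x\<in>#A. norm x < 1) \<and>
      (\<forall>z\<in>unit_disc. B z = c * ((\<Prod>x\<in>#A. z - x) / (\<Prod>x\<in>#A. 1 - cnj x * z)))"
    using a B by (intro exI[of _ "exp (\<i> * of_real \<theta>)"] exI[of _ A]) (auto simp: A_def)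
next
  assume "\<exists>c A. norm c = 1 \<and> size A = d \<and> (\<forall>x\<in>#A. norm x < 1) \<and>
      (\<forall>z\<in>unit_disc. B z = c * ((\<Prod>x\<in>#A. z - x) / (\<Prod>x\<in>#A. 1 - cnj x * z)))"
  then obtain c A where c: "norm c = 1" and A: "size A = d" "\<forall>x\<in>#A. norm x < 1"
    and B: "\<And>z. z \<in> unit_disc \<Longrightarrow>
      B z = c * ((\<Prod>x\<in>#A. z - x) / (\<Prod>x\<in>#A. 1 - cnj x * z))"
    by blast
  obtain l where l: "mset l = A" using ex_mset by blast
  define a where "a j = l ! (j - 1)" for j
  have len: "length l = d" using A l by auto
  have "l = map a [1..<Suc d]"
    by (rule nth_equalityI) (simp_all add: len a_def del: upt_Suc)
  then have "A = mset (map a [1..<Suc d])"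
    using l by simp
  then have Aa: "A = image_mset a (mset_set {1..d})"
    by (simp add: atLeastLessThanSuc_atLeastAtMost del: upt_Suc)
  have *: "(\<Prod>j=1..d. (z - a j) / (1 - cnj (a j) * z))
      = (\<Prod>x\<in>#A. z - x) / (\<Prod>x\<in>#A. 1 - cnj x * z)" for z
    by (simp add: Aa prod_dividef prod_unfold_prod_mset image_mset.compositionality o_def)
  have "c = exp (\<i> * of_real (Arg c))"
    using c by (metis cis_Arg cis_conv_exp norm_zero sgn_eq zero_neq_one of_real_1 div_by_1)
  then show "blaschke_product d B"
    unfolding blaschke_product_def
    using A(2) B * by (intro exI[of _ "Arg c"] exI[of _ a]) (auto simp: Aa)
qed

lemma blaschke_product_0_iff:
  "blaschke_product 0 B \<longleftrightarrow> (\<exists>c. norm c = 1 \<and> (\<forall>z\<in>unit_disc. B z = c))"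
  unfolding blaschke_product_iff_mset by simp

text \<open>Divided by \<open>(norm (1 - cnj a * w))\<^sup>2\<close>, this is the formula for \<open>1 - (norm T)\<^sup>2\<close>, where $T$ is the
Moebius image of $w$. The quotient-free form is meaningful for every $w$, also outside the disc.\<close>

lemma norm_moebius_identity:
  fixes a w :: complex
  shows "(norm (1 - cnj a * w))\<^sup>2 - (norm (w - a))\<^sup>2 = (1 - (norm a)\<^sup>2) * (1 - (norm w)\<^sup>2)"
  unfolding cmod_power2 by (simp add: power2_eq_square algebra_simps)

lemma one_minus_cnj_mult_nonzero:
  fixes a w :: complex
  assumes "norm a < 1" "norm w \<le> 1"
  shows "1 - cnj a * w \<noteq> 0"
proof
  assume "1 - cnj a * w = 0"
  then have "norm (cnj a * w) = 1" by simp
  moreover have "norm a * norm w \<le> norm a * 1"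
    using assms by (intro mult_left_mono) auto
  ultimately show False using assms by (simp add: norm_mult)
qed

lemma prod_mset_one_minus_cnj_nonzero:
  fixes A :: "complex multiset"
  assumes "\<forall>x\<in>#A. norm x < 1" "norm z \<le> 1"
  shows "(\<Prod>x\<in>#A. 1 - cnj x * z) \<noteq> 0"
  using assms one_minus_cnj_mult_nonzero[OF _ assms(2)] by (induction A) auto

text \<open>Numerator and denominator of a Blaschke product: outside the disc the quotient has modulus at
least $1$, because each factor does by the identity above. This confines the solutions of
\<open>B z = a\<close> with \<open>norm a < 1\<close> to the disc.\<close>

lemma prod_mset_norm_le_outside_disc:
  fixes A :: "complex multiset"
  assumes "\<forall>x\<in>#A. norm x < 1" "norm z \<ge> 1"
  shows "norm (\<Prod>x\<in>#A. 1 - cnj x * z) \<le> norm (\<Prod>x\<in>#A. z - x)"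
  using assms(1)
proof (induction A)
  case (add x A)
  have "(1 - (norm x)\<^sup>2) * (1 - (norm z)\<^sup>2) \<le> 0"
    using add.prems assms(2)
    by (intro mult_nonneg_nonpos) (auto simp: power_le_one)
  then have "(norm (1 - cnj x * z))\<^sup>2 \<le> (norm (z - x))\<^sup>2"
    using norm_moebius_identity[of x z] by linarith
  then have "norm (1 - cnj x * z) \<le> norm (z - x)"
    by (rule power2_le_imp_le) simp
  then show ?case
    using add by (auto simp: norm_mult intro!: mult_mono)
qed auto

lemma prod_mset_norm_nonzero_outside_disc:
  fixes A :: "complex multiset"
  assumes "\<forall>x\<in>#A. norm x < 1" "norm z \<ge> 1"
  shows "(\<Prod>x\<in>#A. z - x) \<noteq> 0"
  using assms by (induction A) auto

text \<open>The conjugate reversal \<open>N(z) \<mapsto> z\<^sup>d cnj (N (1 / cnj z))\<close> of polynomials of degree at most $d$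
exchanges the numerator and the denominator of a Blaschke product.\<close>

lemma reflect_prod_mset:
  fixes A :: "complex multiset"
  assumes "z \<noteq> 0"
  shows "z ^ size A * cnj (\<Prod>x\<in>#A. 1 / cnj z - x) = (\<Prod>x\<in>#A. 1 - cnj x * z)"
    and "z ^ size A * cnj (\<Prod>x\<in>#A. 1 - cnj x * (1 / cnj z)) = (\<Prod>x\<in>#A. z - x)"
  using assms by (induction A) (auto simp: field_simps)

lemma poly_prod_mset_linear:
  fixes A :: "complex multiset"
  shows "poly (\<Prod>x\<in>#A. [:-x, 1:]) z = (\<Prod>x\<in>#A. z - x)"
    and "poly (\<Prod>x\<in>#A. [:1, - cnj x:]) z = (\<Prod>x\<in>#A. 1 - cnj x * z)"
  by (induction A) (auto simp: algebra_simps)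

lemma coeff_prod_mset_linear:
  fixes A :: "complex multiset" and u v :: "complex \<Rightarrow> complex"
  shows "degree (\<Prod>x\<in>#A. [:u x, v x:]) \<le> size A"
    and "coeff (\<Prod>x\<in>#A. [:u x, v x:]) (size A) = (\<Prod>x\<in>#A. v x)"
proof (induction A)
  case (add x A)
  {
    case 1
    have "degree ([:u x, v x:] * (\<Prod>x\<in>#A. [:u x, v x:])) \<le> 1 + size A"
      using add by (intro order.trans[OF degree_mult_le] add_mono) auto
    then show ?case by simp
  next
    case 2
    show ?case using add by (simp add: coeff_eq_0 le_less_Suc_eq less_Suc_eq_le)
  }
qed auto

text \<open>Write \<open>B = c num / den\<close>. The composite with the Moebius map is, up to a constant factor, the
quotient of \<open>N = c num - a den\<close> by its conjugate reversal. So it is enough to factor $N$: its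
coefficient of order $d$ does not vanish, hence it has exactly $d$ roots, and they lie in the disc
because \<open>norm num \<ge> norm den\<close> outside.\<close>

lemma blaschke_product_moebius:
  assumes "blaschke_product d B" "norm a < 1"
  shows "blaschke_product d (\<lambda>z. Moebius_function 0 a (B z))"
proof -
  obtain c A where c: "norm c = 1" and A: "size A = d" "\<forall>x\<in>#A. norm x < 1"
    and B: "\<And>z. z \<in> unit_disc \<Longrightarrow>
      B z = c * ((\<Prod>x\<in>#A. z - x) / (\<Prod>x\<in>#A. 1 - cnj x * z))"
    using assms(1) unfolding blaschke_product_iff_mset by blast
  define num den where "num z = (\<Prod>x\<in>#A. z - x)" and "den z = (\<Prod>x\<in>#A. 1 - cnj x * z)" for z
  define N where "N = smult c (\<Prod>x\<in>#A. [:-x, 1:]) - smult a (\<Prod>x\<in>#A. [:1, - cnj x:])"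
  have polyN: "poly N z = c * num z - a * den z" for z
    by (simp add: N_def num_def den_def poly_prod_mset_linear)
  have degN: "degree N \<le> d"
    unfolding N_def using A coeff_prod_mset_linear(1)[of uminus "\<lambda>_. 1" A]
      coeff_prod_mset_linear(1)[of "\<lambda>_. 1" "\<lambda>x. - cnj x" A]
    by (intro degree_diff_le order.trans[OF degree_smult_le]) auto
  have coeffN: "coeff N d = c - a * (\<Prod>x\<in>#A. - cnj x)"
    unfolding N_def using A coeff_prod_mset_linear(2)[of uminus "\<lambda>_. 1" A]
      coeff_prod_mset_linear(2)[of "\<lambda>_. 1" "\<lambda>x. - cnj x" A]
    by simp
  have "norm (\<Prod>x\<in>#A. - cnj x) \<le> 1"
    using A(2) by (induction A) (auto simp: norm_mult intro!: mult_le_one)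
  then have "norm (a * (\<Prod>x\<in>#A. - cnj x)) \<le> norm a * 1"
    unfolding norm_mult by (intro mult_left_mono) auto
  then have lead0: "coeff N d \<noteq> 0"
    using c assms(2) unfolding coeffN by (metis eq_iff_diff_eq_0 mult.right_neutral not_less)
  then have degN': "degree N = d"
    using degN le_degree[of N d] by simp
  define c' where "c' = coeff N d"
  obtain A' where A': "size A' = d" and N: "N = smult c' (\<Prod>x\<in>#A'. [:-x, 1:])"
    using complex_poly_decompose_multiset[of N] size_proots_complex[of N] degN' c'_def by metis
  have roots: "norm x < 1" if "x \<in># A'" for x
  proof (rule ccontr)
    assume "\<not> norm x < 1"
    then have x: "norm x \<ge> 1" by simp
    have "(\<Prod>y\<in>#A'. x - y) = 0" using that by (simp add: prod_mset_zero_iff image_iff)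
    then have "poly N x = 0"
      by (simp add: N poly_prod_mset_linear)
    then have "norm (num x) = norm a * norm (den x)"
      unfolding polyN using c by (metis eq_iff_diff_eq_0 mult_1 norm_mult)
    also have "\<dots> \<le> norm a * norm (num x)"
      using prod_mset_norm_le_outside_disc[OF A(2) x] unfolding num_def den_def
      by (intro mult_left_mono) auto
    finally have "(1 - norm a) * norm (num x) \<le> 0" by (simp add: algebra_simps)
    moreover have "norm (num x) > 0"
      using prod_mset_norm_nonzero_outside_disc[OF A(2) x] by (simp add: num_def)
    ultimately show False using assms(2) by (simp add: mult_le_0_iff)
  qed
  define num' den' where "num' z = (\<Prod>x\<in>#A'. z - x)" and "den' z = (\<Prod>x\<in>#A'. 1 - cnj x * z)" for z
  have num': "c * num z - a * den z = c' * num' z" for z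
    using polyN[of z] by (simp add: N poly_prod_mset_linear num'_def)
  have cc: "c * cnj c = 1" using c complex_norm_square[of c] by simp
  \<comment> \<open>The conjugate reversal of both sides of the factorization of $N$; it needs \<open>z \<noteq> 0\<close>, so the origin is separate.\<close>
  have den': "cnj c * den z - cnj a * num z = cnj c' * den' z" for z
  proof (cases "z = 0")
    case True
    have "cnj (\<Prod>x\<in>#A. - cnj x) = (\<Prod>x\<in>#A. - x)" by (induction A) auto
    then show ?thesis using True by (simp add: den_def den'_def num_def c'_def coeffN)
  next
    case False
    have "cnj c' * den' z = z ^ d * cnj (c' * num' (1 / cnj z))"
      using reflect_prod_mset(1)[OF False, of A'] A' by (simp add: num'_def den'_def)
    also have "\<dots> = z ^ d * cnj (c * num (1 / cnj z) - a * den (1 / cnj z))"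
      by (simp only: num')
    also have "\<dots> = cnj c * (z ^ d * cnj (num (1 / cnj z))) - cnj a * (z ^ d * cnj (den (1 / cnj z)))"
      by (simp add: algebra_simps)
    also have "\<dots> = cnj c * den z - cnj a * num z"
      using reflect_prod_mset[OF False, of A] A by (simp add: num_def den_def)
    finally show ?thesis by simp
  qed
  have c'0: "c' \<noteq> 0" using lead0 by (simp add: c'_def)
  have "Moebius_function 0 a (B z) = (c' / (c * cnj c')) * (num' z / den' z)" if z: "z \<in> unit_disc" for z
  proof -
    have d0: "den z \<noteq> 0"
      using prod_mset_one_minus_cnj_nonzero[OF A(2), of z] z by (simp add: den_def)
    have "Moebius_function 0 a (B z) = (c * num z - a * den z) / (den z - cnj a * (c * num z))"
    proof -
      have "B z = c * num z / den z" using B[OF z] by (simp add: num_def den_def)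
      then have "B z - a = (c * num z - a * den z) / den z"
        and "1 - cnj a * B z = (den z - cnj a * (c * num z)) / den z"
        using d0 by (simp_all add: diff_divide_distrib)
      then show ?thesis using d0 by (simp add: Moebius_function_simple)
    qed
    also have "den z - cnj a * (c * num z) = c * (cnj c * den z - cnj a * num z)"
      using cc by (simp add: algebra_simps)
    finally show ?thesis by (simp add: num' den')
  qed
  moreover have "norm (c' / (c * cnj c')) = 1"
    using c c'0 by (simp add: norm_divide norm_mult)
  ultimately show ?thesis
    unfolding blaschke_product_iff_mset using A' roots
    by (intro exI[of _ "c' / (c * cnj c')"] exI[of _ A']) (auto simp: num'_def den'_def)
qed

section \<open>The hyperbolic difference quotient at the origin\<close>

text \<open>The value of the difference quotient at the origin is given by a derivative. Cancelling the
factor $z$ by continuity makes it possible to identify the quotient with a holomorphic function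
from its values elsewhere.\<close>

lemma holomorphic_eq_by_cancelling_z:
  assumes "u holomorphic_on unit_disc" "v holomorphic_on unit_disc"
    and "\<And>z. z \<in> unit_disc \<Longrightarrow> z * u z = z * v z"
    and "z \<in> unit_disc"
  shows "u z = v z"
proof (cases "z = 0")
  case True
  have "isCont u 0" "isCont v 0"
    using assms(1,2) by (auto intro!: continuous_on_interior holomorphic_on_imp_continuous_on)
  then have u: "(u \<longlongrightarrow> u 0) (at 0)" and v: "(v \<longlongrightarrow> v 0) (at 0)"
    by (auto simp: isCont_def)
  have "eventually (\<lambda>z. z \<in> unit_disc - {0}) (at (0::complex))"
    by (rule eventually_at_in_open) auto
  then have "eventually (\<lambda>z. u z = v z) (at 0)"
    by eventually_elim (use assms(3) in auto)
  then have "(v \<longlongrightarrow> u 0) (at 0)"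
    using u by (simp add: tendsto_cong)
  then show ?thesis
    using tendsto_unique[OF _ _ v] True by auto
qed (use assms in auto)

locale disc_self_map =
  fixes g :: "complex \<Rightarrow> complex"
  assumes holo: "g holomorphic_on unit_disc"
    and self_map: "g ` unit_disc \<subseteq> unit_disc"
begin

lemma norm_lt_1: "z \<in> unit_disc \<Longrightarrow> norm (g z) < 1"
  using self_map by (force simp: image_subset_iff)

lemma moebius_compose_holomorphic:
  assumes "norm w < 1"
  shows "(\<lambda>z. Moebius_function 0 w (g z)) holomorphic_on unit_disc"
  using holomorphic_on_compose_gen[OF holo Moebius_function_holomorphic[OF assms, of 0] self_map]
  by (simp add: o_def)

text \<open>The Schwarz lemma for \<open>F = Moebius_function 0 (g 0) \<circ> g\<close>, which vanishes at the origin: the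
difference quotient is \<open>F z / z\<close>, with the singularity removed. If it touches the unit circle
anywhere, $F$ is a rotation, and the quotient is a unimodular constant, that is, a Blaschke product
of degree $0$.\<close>

lemma hyp_diff_quot_0_cases:
  shows hyp_diff_quot_0_holomorphic: "hyp_diff_quot 0 g holomorphic_on unit_disc"
    and hyp_diff_quot_0_factor: "\<And>z. z \<in> unit_disc \<Longrightarrow>
          Moebius_function 0 (g 0) (g z) = z * hyp_diff_quot 0 g z"
    and hyp_diff_quot_0_self_map_or_constant:
          "hyp_diff_quot 0 g ` unit_disc \<subseteq> unit_disc \<or> blaschke_product 0 (hyp_diff_quot 0 g)"
proof -
  define F where "F z = Moebius_function 0 (g 0) (g z)" for z
  have a: "norm (g 0) < 1" by (rule norm_lt_1) simp
  have holF: "F holomorphic_on ball 0 1"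
    using moebius_compose_holomorphic[OF a] by (simp add: F_def[abs_def])
  have F0: "F 0 = 0" by (simp add: F_def Moebius_function_eq_zero)
  have F1: "norm (F z) < 1" if "norm z < 1" for z
    using Moebius_function_norm_lt_1[OF a norm_lt_1] that by (simp add: F_def)
  obtain h where h: "h holomorphic_on ball 0 1" "\<And>z. norm z < 1 \<Longrightarrow> F z = z * h z"
    and h0: "deriv F 0 = h 0"
    by (rule Schwarz3[OF holF F0]) auto
  have "(g has_field_derivative deriv g 0) (at 0)"
    using holo by (intro holomorphic_derivI[of _ "unit_disc"]) auto
  then have "(F has_field_derivative
      deriv g 0 * (1 - cnj (g 0) * g 0) / ((1 - cnj (g 0) * g 0) * (1 - cnj (g 0) * g 0))) (at 0)"
    unfolding F_def Moebius_function_simple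
    using one_minus_cnj_mult_nonzero[OF a less_imp_le[OF a]]
    by (auto intro!: derivative_eq_intros)
  then have "h 0 = deriv g 0 / (1 - cnj (g 0) * g 0)"
    using one_minus_cnj_mult_nonzero[OF a less_imp_le[OF a]] h0 by (simp add: DERIV_imp_deriv)
  moreover have "1 - cnj (g 0) * g 0 = of_real (1 - (norm (g 0))\<^sup>2)"
    using complex_norm_square[of "g 0"] by (simp add: mult.commute)
  ultimately have hq0: "hyp_diff_quot 0 g 0 = h 0"
    by (simp add: hyp_diff_quot_def)
  have hq: "hyp_diff_quot 0 g z = h z" if "z \<in> unit_disc" for z
  proof (cases "z = 0")
    case False
    then show ?thesis
      using h(2)[of z] that by (simp add: hyp_diff_quot_def F_def Moebius_function_simple)
  qed (use hq0 in simp)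
  show "hyp_diff_quot 0 g holomorphic_on unit_disc"
    using h(1) by (rule holomorphic_transform) (simp add: hq)
  show "\<And>z. z \<in> unit_disc \<Longrightarrow> Moebius_function 0 (g 0) (g z) = z * hyp_diff_quot 0 g z"
    using h(2) hq by (simp add: F_def)
  have *: "blaschke_product 0 (hyp_diff_quot 0 g)"
    if touch: "z \<in> unit_disc" "norm (h z) \<ge> 1" for z
  proof -
    have "(\<exists>z. norm z < 1 \<and> z \<noteq> 0 \<and> norm (F z) = norm z) \<or> norm (deriv F 0) = 1"
    proof (cases "z = 0")
      case True
      then show ?thesis
        using Schwarz_Lemma(2)[OF holF F0 F1, of 0] touch h0 by auto
    next
      case False
      have "norm z * 1 \<le> norm z * norm (h z)"
        using touch by (intro mult_left_mono) auto
      then have "norm (F z) = norm z"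
        using Schwarz_Lemma(1)[OF holF F0 F1, of z] touch h(2)[of z] by (simp add: norm_mult)
      then show ?thesis using False touch by auto
    qed
    then obtain \<alpha> where \<alpha>: "\<forall>z. norm z < 1 \<longrightarrow> F z = \<alpha> * z" "norm \<alpha> = 1"
      using Schwarz_Lemma(3)[OF holF F0 F1, of 0] by auto
    have "h z = \<alpha>" if "z \<in> unit_disc" for z
      using h(1) holomorphic_on_const _ that
      by (rule holomorphic_eq_by_cancelling_z) (use \<alpha>(1) h(2) in \<open>auto simp: mult.commute\<close>)
    then show ?thesis
      using \<alpha>(2) hq by (auto simp: blaschke_product_0_iff)
  qed
  show "hyp_diff_quot 0 g ` unit_disc \<subseteq> unit_disc \<or> blaschke_product 0 (hyp_diff_quot 0 g)"
  proof (rule disjCI)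
    assume "\<not> blaschke_product 0 (hyp_diff_quot 0 g)"
    then show "hyp_diff_quot 0 g ` unit_disc \<subseteq> unit_disc"
      using * hq by (force simp: not_le)
  qed
qed

lemma norm_hyp_diff_quot_0_le_1:
  assumes "z \<in> unit_disc"
  shows "norm (hyp_diff_quot 0 g z) \<le> 1"
  using hyp_diff_quot_0_self_map_or_constant
proof
  assume "hyp_diff_quot 0 g ` unit_disc \<subseteq> unit_disc"
  then have "hyp_diff_quot 0 g z \<in> unit_disc" using assms by blast
  then show ?thesis by simp
next
  assume "blaschke_product 0 (hyp_diff_quot 0 g)"
  then show ?thesis using assms by (auto simp: blaschke_product_0_iff)
qed

text \<open>Passing between $g$ and its difference quotient means composing with a Moebius map, which
preserves the degree, and removing or adding the zero at the origin.\<close>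

lemma blaschke_product_Suc_iff:
  "blaschke_product (Suc d) g \<longleftrightarrow> blaschke_product d (hyp_diff_quot 0 g)"
proof
  have a: "norm (g 0) < 1" by (rule norm_lt_1) simp
  {
    assume "blaschke_product (Suc d) g"
    then have "blaschke_product (Suc d) (\<lambda>z. Moebius_function 0 (g 0) (g z))"
      using a by (rule blaschke_product_moebius)
    then obtain c A where c: "norm c = 1" and A: "size A = Suc d" "\<forall>x\<in>#A. norm x < 1"
      and B: "\<And>z. z \<in> unit_disc \<Longrightarrow> Moebius_function 0 (g 0) (g z)
          = c * ((\<Prod>x\<in>#A. z - x) / (\<Prod>x\<in>#A. 1 - cnj x * z))"
      unfolding blaschke_product_iff_mset by blast
    have "(\<Prod>x\<in>#A. 0 - x) = 0"
      using B[of 0] c by (auto simp: Moebius_function_eq_zero)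
    then have "0 \<in># A" by (auto simp: prod_mset_zero_iff)
    then obtain A' where A': "A = add_mset 0 A'" by (metis multi_member_split)
    define b where "b z = c * ((\<Prod>x\<in>#A'. z - x) / (\<Prod>x\<in>#A'. 1 - cnj x * z))" for z
    have hol: "(\<lambda>z. \<Prod>x\<in>#A'. u x + v x * z) holomorphic_on unit_disc"
      for u v :: "complex \<Rightarrow> complex"
      by (induction A') (auto intro!: holomorphic_intros)
    have "b holomorphic_on unit_disc"
      unfolding b_def using hol[of uminus "\<lambda>_. 1"] hol[of "\<lambda>_. 1" "\<lambda>x. - cnj x"]
        prod_mset_one_minus_cnj_nonzero[of A'] A(2) A'
      by (intro holomorphic_intros) auto
    moreover have "z * hyp_diff_quot 0 g z = z * b z" if "z \<in> unit_disc" for z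
      using hyp_diff_quot_0_factor[OF that] B[OF that] by (simp add: A' b_def mult.left_commute)
    ultimately have "hyp_diff_quot 0 g z = b z" if "z \<in> unit_disc" for z
      using hyp_diff_quot_0_holomorphic that by (blast intro: holomorphic_eq_by_cancelling_z)
    then show "blaschke_product d (hyp_diff_quot 0 g)"
      unfolding blaschke_product_iff_mset using c A A'
      by (intro exI[of _ c] exI[of _ A']) (auto simp: b_def)
  }
  {
    assume "blaschke_product d (hyp_diff_quot 0 g)"
    then obtain c A where c: "norm c = 1" and A: "size A = d" "\<forall>x\<in>#A. norm x < 1"
      and B: "\<And>z. z \<in> unit_disc \<Longrightarrow> hyp_diff_quot 0 g z
          = c * ((\<Prod>x\<in>#A. z - x) / (\<Prod>x\<in>#A. 1 - cnj x * z))"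
      unfolding blaschke_product_iff_mset by blast
    have zB: "blaschke_product (Suc d) (\<lambda>z. Moebius_function 0 (g 0) (g z))"
      unfolding blaschke_product_iff_mset using c A
      by (intro exI[of _ c] exI[of _ "add_mset 0 A"]) (auto simp: hyp_diff_quot_0_factor B)
    have "blaschke_product (Suc d)
        (\<lambda>z. Moebius_function 0 (- g 0) (Moebius_function 0 (g 0) (g z)))"
      using blaschke_product_moebius[OF zB, of "- g 0"] a by simp
    moreover have "Moebius_function 0 (- g 0) (Moebius_function 0 (g 0) (g z)) = g z"
      if "z \<in> unit_disc" for z
      using a norm_lt_1[OF that] by (intro Moebius_function_compose) auto
    ultimately show "blaschke_product (Suc d) g"
      by (simp add: blaschke_product_def)
  }
qed

end

section \<open>The boundary dilation along sequences\<close>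

lemma boundary_dilation_nonneg:
  assumes "\<And>z. z \<in> unit_disc \<Longrightarrow> norm (g z) \<le> 1"
  shows "0 \<le> boundary_dilation g \<sigma>"
  unfolding boundary_dilation_def
  by (rule Liminf_bounded) (use assms in \<open>auto simp: eventually_at_filter zero_ereal_def\<close>)

lemma tendsto_boundary_imp_tendsto_within_disc:
  assumes "\<sigma> \<in> unit_circle" "\<And>n. z n \<in> unit_disc" "z \<longlonglongrightarrow> \<sigma>"
  shows "filterlim z (at \<sigma> within unit_disc) sequentially"
proof -
  have "z n \<noteq> \<sigma>" for n
    using assms(1) assms(2)[of n] by auto
  then show ?thesis
    unfolding filterlim_at using assms by (auto intro!: always_eventually)
qed

lemma boundary_dilation_le_of_sequence:
  assumes "\<sigma> \<in> unit_circle" "\<And>n. z n \<in> unit_disc" "z \<longlonglongrightarrow> \<sigma>"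
    and lim: "(\<lambda>n. (1 - norm (g (z n))) / (1 - norm (z n))) \<longlonglongrightarrow> b"
  shows "boundary_dilation g \<sigma> \<le> ereal b"
proof (rule dense_le)
  fix y assume "y < boundary_dilation g \<sigma>"
  then have "eventually (\<lambda>z. y < ereal ((1 - norm (g z)) / (1 - norm z))) (at \<sigma> within unit_disc)"
    unfolding boundary_dilation_def by (rule less_LiminfD)
  then have "eventually (\<lambda>n. y < ereal ((1 - norm (g (z n))) / (1 - norm (z n)))) sequentially"
    by (rule eventually_compose_filterlim[OF _ tendsto_boundary_imp_tendsto_within_disc[OF assms(1-3)]])
  then have "eventually (\<lambda>n. y \<le> ereal ((1 - norm (g (z n))) / (1 - norm (z n)))) sequentially"
    by eventually_elim simp
  moreover have "(\<lambda>n. ereal ((1 - norm (g (z n))) / (1 - norm (z n)))) \<longlonglongrightarrow> ereal b"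
    using lim by simp
  ultimately show "y \<le> ereal b"
    by (intro tendsto_lowerbound) auto
qed

lemma boundary_dilation_attained:
  assumes "\<sigma> \<in> unit_circle" "boundary_dilation g \<sigma> = ereal b"
  obtains z where "\<And>n. z n \<in> unit_disc" "z \<longlonglongrightarrow> \<sigma>"
    "(\<lambda>n. (1 - norm (g (z n))) / (1 - norm (z n))) \<longlonglongrightarrow> b"
proof -
  let ?q = "\<lambda>z. (1 - norm (g z)) / (1 - norm z)"
  have "\<exists>z\<in>unit_disc. dist z \<sigma> < inverse (Suc n) \<and> \<bar>?q z - b\<bar> < inverse (Suc n)" for n
  proof -
    let ?e = "inverse (real (Suc n))"
    have e: "?e > 0" by simp
    have "\<not> eventually (\<lambda>z. ereal (b + ?e) \<le> ereal (?q z)) (at \<sigma> within unit_disc)"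
    proof
      assume "eventually (\<lambda>z. ereal (b + ?e) \<le> ereal (?q z)) (at \<sigma> within unit_disc)"
      then have "ereal (b + ?e) \<le> boundary_dilation g \<sigma>"
        unfolding boundary_dilation_def by (rule Liminf_bounded)
      then show False using assms(2) by simp
    qed
    then have freq: "frequently (\<lambda>z. ?q z < b + ?e) (at \<sigma> within unit_disc)"
      by (simp add: frequently_def not_less)
    have "ereal (b - ?e) < boundary_dilation g \<sigma>"
      using assms(2) by simp
    then have "eventually (\<lambda>z. ereal (b - ?e) < ereal (?q z)) (at \<sigma> within unit_disc)"
      unfolding boundary_dilation_def by (rule less_LiminfD)
    moreover have "eventually (\<lambda>z. dist z \<sigma> < ?e) (at \<sigma> within unit_disc)"
      unfolding eventually_at using e by blast
    moreover have "eventually (\<lambda>z. z \<in> unit_disc) (at \<sigma> within unit_disc)"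
      unfolding eventually_at using zero_less_one by blast
    ultimately have "eventually (\<lambda>z. b - ?e < ?q z \<and> dist z \<sigma> < ?e \<and> z \<in> unit_disc)
        (at \<sigma> within unit_disc)"
      by eventually_elim simp
    from frequently_ex[OF frequently_eventually_frequently[OF freq this]]
    show ?thesis by (auto simp: abs_less_iff intro!: bexI)
  qed
  then obtain z where z: "\<And>n. z n \<in> unit_disc" "\<And>n. dist (z n) \<sigma> < inverse (Suc n)"
    "\<And>n. \<bar>?q (z n) - b\<bar> < inverse (Suc n)"
    by metis
  have "z \<longlonglongrightarrow> \<sigma>"
    unfolding tendsto_dist_iff[of z]
    by (rule tendsto_0_le[OF LIMSEQ_inverse_real_of_nat, of _ 1])
      (use z(2) in \<open>auto intro!: always_eventually less_imp_le\<close>)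
  moreover have "(\<lambda>n. ?q (z n)) \<longlonglongrightarrow> b"
    unfolding LIM_zero_iff[of _ b, symmetric]
    by (rule tendsto_0_le[OF LIMSEQ_inverse_real_of_nat, of _ 1])
      (use z(3) in \<open>auto intro!: always_eventually less_imp_le\<close>)
  ultimately show ?thesis using that z(1) by blast
qed

text \<open>In the dilation quotient, moduli may be replaced by squared moduli: either form of convergence
forces the modulus in the numerator to tend to $1$, so the quotients differ by a factor tending to
$1$. Squared moduli obey exact identities under Moebius maps.\<close>

lemma quotient_tendsto_iff_squared:
  fixes s t :: "nat \<Rightarrow> real"
  assumes s: "\<And>n. 0 \<le> s n" "\<And>n. s n < 1" "s \<longlonglongrightarrow> 1" and t: "\<And>n. 0 \<le> t n"
  shows "(\<lambda>n. (1 - t n) / (1 - s n)) \<longlonglongrightarrow> b \<longleftrightarrow>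
    (\<lambda>n. (1 - (t n)\<^sup>2) / (1 - (s n)\<^sup>2)) \<longlonglongrightarrow> b"
proof
  have sq: "1 - (s n)\<^sup>2 = (1 - s n) * (1 + s n)" "1 - (t n)\<^sup>2 = (1 - t n) * (1 + t n)" for n
    by (simp_all add: power2_eq_square algebra_simps)
  have ne: "1 - s n \<noteq> 0" "1 + s n \<noteq> 0" "1 + t n \<noteq> 0" "1 - (s n)\<^sup>2 \<noteq> 0" for n
    using s(1,2)[of n] t[of n] by (auto simp: sq)
  {
    assume L: "(\<lambda>n. (1 - t n) / (1 - s n)) \<longlonglongrightarrow> b"
    have "(\<lambda>n. 1 - (1 - t n) / (1 - s n) * (1 - s n)) \<longlonglongrightarrow> 1 - b * (1 - 1)"
      by (intro tendsto_intros L s)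
    then have "t \<longlonglongrightarrow> 1" using ne by simp
    then have "(\<lambda>n. (1 - t n) / (1 - s n) * ((1 + t n) / (1 + s n))) \<longlonglongrightarrow> b * ((1 + 1) / (1 + 1))"
      by (intro tendsto_intros L s) auto
    then show "(\<lambda>n. (1 - (t n)\<^sup>2) / (1 - (s n)\<^sup>2)) \<longlonglongrightarrow> b" by (simp add: sq)
  }
  {
    assume L: "(\<lambda>n. (1 - (t n)\<^sup>2) / (1 - (s n)\<^sup>2)) \<longlonglongrightarrow> b"
    have "(\<lambda>n. sqrt (1 - (1 - (t n)\<^sup>2) / (1 - (s n)\<^sup>2) * (1 - (s n)\<^sup>2))) \<longlonglongrightarrow> sqrt (1 - b * (1 - 1\<^sup>2))"
      by (intro tendsto_intros L s)
    then have "t \<longlonglongrightarrow> 1" using ne t by simp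
    then have "(\<lambda>n. (1 - (t n)\<^sup>2) / (1 - (s n)\<^sup>2) * ((1 + s n) / (1 + t n))) \<longlonglongrightarrow> b * ((1 + 1) / (1 + 1))"
      by (intro tendsto_intros L s) auto
    moreover have "(1 - (t n)\<^sup>2) / (1 - (s n)\<^sup>2) * ((1 + s n) / (1 + t n)) = (1 - t n) / (1 - s n)" for n
      using ne[of n] by (simp add: sq)
    ultimately show "(\<lambda>n. (1 - t n) / (1 - s n)) \<longlonglongrightarrow> b" by simp
  }
qed

lemma dilation_quotient_tendsto_iff_squared:
  assumes "\<sigma> \<in> unit_circle" "\<And>n. z n \<in> unit_disc" "z \<longlonglongrightarrow> \<sigma>"
  shows "(\<lambda>n. (1 - norm (g (z n))) / (1 - norm (z n))) \<longlonglongrightarrow> b \<longleftrightarrow>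
    (\<lambda>n. (1 - (norm (g (z n)))\<^sup>2) / (1 - (norm (z n))\<^sup>2)) \<longlonglongrightarrow> b"
  using assms tendsto_norm[OF assms(3)]
  by (intro quotient_tendsto_iff_squared) auto

section \<open>Julia's inequality\<close>

context disc_self_map
begin

text \<open>The Schwarz lemma for $g$ with both \<open>w\<close> and \<open>g w\<close> moved to the origin, multiplied out so that
one can let \<open>w\<close> tend to the boundary.\<close>

lemma schwarz_pick:
  assumes w: "w \<in> unit_disc" and z: "z \<in> unit_disc"
  shows "(norm (1 - cnj (g w) * g z))\<^sup>2 * ((1 - (norm w)\<^sup>2) * (1 - (norm z)\<^sup>2))
    \<le> (norm (1 - cnj w * z))\<^sup>2 * ((1 - (norm (g w))\<^sup>2) * (1 - (norm (g z))\<^sup>2))"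
proof -
  define F where "F \<zeta> = Moebius_function 0 (g w) (g (Moebius_function 0 (- w) \<zeta>))" for \<zeta>
  have w1: "norm w < 1" "norm z < 1" using w z by auto
  have gw: "norm (g w) < 1" and gz: "norm (g z) < 1" using norm_lt_1 w z by auto
  have maps: "Moebius_function 0 (- w) ` unit_disc \<subseteq> unit_disc"
    using w1 by (auto intro!: Moebius_function_norm_lt_1)
  have "F holomorphic_on unit_disc"
    using holomorphic_on_compose_gen[OF Moebius_function_holomorphic[of "- w" 0]
        moebius_compose_holomorphic[OF gw] maps] w1
    by (simp add: F_def[abs_def] o_def)
  moreover have "F 0 = 0"
    by (simp add: F_def Moebius_function_of_zero Moebius_function_eq_zero)
  moreover have "norm (F \<zeta>) < 1" if "norm \<zeta> < 1" for \<zeta>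
    unfolding F_def using that w1 gw
    by (auto intro!: Moebius_function_norm_lt_1 norm_lt_1)
  moreover have "norm (Moebius_function 0 w z) < 1"
    using w1 by (intro Moebius_function_norm_lt_1)
  ultimately have "norm (F (Moebius_function 0 w z)) \<le> norm (Moebius_function 0 w z)"
    by (intro Schwarz_Lemma(1)) auto
  moreover have "Moebius_function 0 (- w) (Moebius_function 0 w z) = z"
    using w1 by (intro Moebius_function_compose) auto
  ultimately have le: "norm (g z - g w) / norm (1 - cnj (g w) * g z) \<le> norm (z - w) / norm (1 - cnj w * z)"
    by (simp add: F_def Moebius_function_simple norm_divide)
  have pos: "norm (1 - cnj (g w) * g z) > 0" "norm (1 - cnj w * z) > 0"
    using one_minus_cnj_mult_nonzero w1 gw gz by auto
  have "norm (g z - g w) * norm (1 - cnj w * z) \<le> norm (z - w) * norm (1 - cnj (g w) * g z)"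
    using le pos by (simp add: field_simps)
  then have "(norm (g z - g w))\<^sup>2 * (norm (1 - cnj w * z))\<^sup>2
      \<le> (norm (z - w))\<^sup>2 * (norm (1 - cnj (g w) * g z))\<^sup>2"
    unfolding power_mult_distrib[symmetric] by (rule power_mono) simp
  then show ?thesis
    unfolding norm_moebius_identity[symmetric] by (simp add: algebra_simps)
qed

text \<open>By Schwarz-Pick with \<open>w = 0\<close>, the dilation quotient has a positive lower bound on the disc. This
is what excludes self-maps of the disc from having dilation $0$.\<close>

lemma dilation_pos:
  assumes "\<sigma> \<in> unit_circle"
  shows "boundary_dilation g \<sigma> > 0"
proof -
  have a: "norm (g 0) < 1" by (rule norm_lt_1) simp
  \<comment> \<open>The factor 2 bounds \<open>1 + norm (g z)\<close>; any positive constant suffices for the conclusion.\<close>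
  have bound: "(1 - norm (g 0)) / (1 + norm (g 0)) / 2 \<le> (1 - norm (g z)) / (1 - norm z)"
    if z: "z \<in> unit_disc" for z
  proof -
    have z1: "norm z < 1" and gz: "norm (g z) < 1" using z norm_lt_1 by auto
    have "(1 - norm (g 0))\<^sup>2 * (1 - norm z) \<le> (norm (1 - cnj (g 0) * g z))\<^sup>2 * (1 - (norm z)\<^sup>2)"
    proof (intro mult_mono power_mono)
      have "norm (g 0) * norm (g z) \<le> norm (g 0) * 1"
        using gz by (intro mult_left_mono) auto
      then show "1 - norm (g 0) \<le> norm (1 - cnj (g 0) * g z)"
        using norm_triangle_ineq2[of 1 "cnj (g 0) * g z"] by (simp add: norm_mult)
      show "1 - norm z \<le> 1 - (norm z)\<^sup>2"
        using z1 by (simp add: power2_eq_square mult_left_le)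
    qed (use a z1 in auto)
    also have "\<dots> \<le> (1 - (norm (g 0))\<^sup>2) * (1 - (norm (g z))\<^sup>2)"
      using schwarz_pick[of 0 z] z by simp
    also have "\<dots> \<le> (1 - (norm (g 0))\<^sup>2) * (2 * (1 - norm (g z)))"
    proof (intro mult_left_mono)
      have "(1 + norm (g z)) * (1 - norm (g z)) \<le> 2 * (1 - norm (g z))"
        using gz by (intro mult_right_mono) auto
      then show "1 - (norm (g z))\<^sup>2 \<le> 2 * (1 - norm (g z))"
        by (simp add: power2_eq_square algebra_simps)
    qed (use a in \<open>simp add: power_le_one\<close>)
    also have "1 - (norm (g 0))\<^sup>2 = (1 - norm (g 0)) * (1 + norm (g 0))"
      by (simp add: power2_eq_square algebra_simps)
    finally have "(1 - norm (g 0)) * ((1 - norm (g 0)) * (1 - norm z))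
        \<le> (1 - norm (g 0)) * ((1 + norm (g 0)) * (2 * (1 - norm (g z))))"
      by (simp add: power2_eq_square mult.assoc)
    then have "(1 - norm (g 0)) * (1 - norm z) \<le> (1 + norm (g 0)) * (2 * (1 - norm (g z)))"
      using a by simp
    moreover have "1 + norm (g 0) > 0" by (simp add: add_pos_nonneg)
    ultimately show ?thesis using z1 by (simp add: field_simps)
  qed
  have "ereal ((1 - norm (g 0)) / (1 + norm (g 0)) / 2) \<le> boundary_dilation g \<sigma>"
    unfolding boundary_dilation_def
    by (rule Liminf_bounded) (use bound in \<open>auto simp: eventually_at_filter\<close>)
  moreover have "(1 - norm (g 0)) / (1 + norm (g 0)) / 2 > 0"
    using a by (intro divide_pos_pos) (auto intro: add_pos_nonneg)
  ultimately show ?thesis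
    by (meson ereal_less(2) less_le_trans)
qed

text \<open>The limit of the Schwarz-Pick inequality along a sequence that attains the dilation, thinned
out by compactness so that the values of $g$ converge; their limit \<open>\<eta>\<close> is unimodular because the
quotient stays bounded.\<close>

lemma julia_inequality:
  assumes \<sigma>: "\<sigma> \<in> unit_circle" and b: "boundary_dilation g \<sigma> = ereal b"
  obtains \<eta> where "\<eta> \<in> unit_circle"
    "\<And>z. z \<in> unit_disc \<Longrightarrow>
      (norm (\<eta> - g z))\<^sup>2 * (1 - (norm z)\<^sup>2) \<le> b * (norm (\<sigma> - z))\<^sup>2 * (1 - (norm (g z))\<^sup>2)"
proof -
  obtain w where w: "\<And>n. w n \<in> unit_disc" "w \<longlonglongrightarrow> \<sigma>"
    and q: "(\<lambda>n. (1 - norm (g (w n))) / (1 - norm (w n))) \<longlonglongrightarrow> b"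
    using boundary_dilation_attained[OF assms] by blast
  have "\<forall>n. (g \<circ> w) n \<in> cball 0 1"
    using norm_lt_1[OF w(1)] by (simp add: less_imp_le)
  then obtain \<eta> r where r: "strict_mono r" and \<eta>: "((g \<circ> w) \<circ> r) \<longlonglongrightarrow> \<eta>"
    using compact_imp_seq_compact[OF compact_cball] unfolding seq_compact_def by metis
  define v where "v = w \<circ> r"
  have v: "v n \<in> unit_disc" for n using w by (simp add: v_def)
  have v\<sigma>: "v \<longlonglongrightarrow> \<sigma>"
    unfolding v_def by (rule LIMSEQ_subseq_LIMSEQ[OF w(2) r])
  have g\<eta>: "(\<lambda>n. g (v n)) \<longlonglongrightarrow> \<eta>" using \<eta> by (simp add: v_def o_def)
  have q1: "(\<lambda>n. (1 - norm (g (v n))) / (1 - norm (v n))) \<longlonglongrightarrow> b"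
    using LIMSEQ_subseq_LIMSEQ[OF q r] by (simp add: v_def o_def)
  then have q2: "(\<lambda>n. (1 - (norm (g (v n)))\<^sup>2) / (1 - (norm (v n))\<^sup>2)) \<longlonglongrightarrow> b"
    using dilation_quotient_tendsto_iff_squared[OF \<sigma> v v\<sigma>] by blast
  have v1: "norm (v n) < 1" for n using v[of n] by simp
  have vpos: "1 - (norm (v n))\<^sup>2 > 0" for n
    using v1[of n] by (simp add: abs_square_less_1)
  have n\<sigma>: "norm \<sigma> = 1" using \<sigma> by simp
  have "(\<lambda>n. 1 - (1 - norm (g (v n))) / (1 - norm (v n)) * (1 - norm (v n))) \<longlonglongrightarrow> 1 - b * (1 - norm \<sigma>)"
    by (intro tendsto_intros q1 v\<sigma>)
  moreover have "1 - norm (v n) \<noteq> 0" for n using v1[of n] by simp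
  ultimately have "(\<lambda>n. norm (g (v n))) \<longlonglongrightarrow> 1" by (simp add: n\<sigma>)
  then have n\<eta>: "norm \<eta> = 1"
    using tendsto_norm[OF g\<eta>] LIMSEQ_unique by blast
  \<comment> \<open>On the unit circle the Schwarz-Pick denominators are distances.\<close>
  have rot: "norm (1 - cnj \<xi> * u) = norm (\<xi> - u)" if "norm \<xi> = 1" for \<xi> u :: complex
  proof -
    have "cnj \<xi> * \<xi> = 1"
      using that complex_norm_square[of \<xi>] by (simp add: mult.commute)
    then have "1 - cnj \<xi> * u = cnj \<xi> * (\<xi> - u)" by (simp add: algebra_simps)
    then show ?thesis using that by (simp add: norm_mult)
  qed
  have "(norm (\<eta> - g z))\<^sup>2 * (1 - (norm z)\<^sup>2) \<le> b * (norm (\<sigma> - z))\<^sup>2 * (1 - (norm (g z))\<^sup>2)"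
    if z: "z \<in> unit_disc" for z
  proof -
    have "(\<lambda>n. (norm (1 - cnj (g (v n)) * g z))\<^sup>2 * (1 - (norm z)\<^sup>2))
        \<longlonglongrightarrow> (norm (1 - cnj \<eta> * g z))\<^sup>2 * (1 - (norm z)\<^sup>2)"
      by (intro tendsto_intros g\<eta>)
    moreover have "(\<lambda>n. (1 - (norm (g (v n)))\<^sup>2) / (1 - (norm (v n))\<^sup>2)
          * (norm (1 - cnj (v n) * z))\<^sup>2 * (1 - (norm (g z))\<^sup>2))
        \<longlonglongrightarrow> b * (norm (1 - cnj \<sigma> * z))\<^sup>2 * (1 - (norm (g z))\<^sup>2)"
      by (intro tendsto_intros q2 v\<sigma>)
    moreover have "(norm (1 - cnj (g (v n)) * g z))\<^sup>2 * (1 - (norm z)\<^sup>2)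
        \<le> (1 - (norm (g (v n)))\<^sup>2) / (1 - (norm (v n))\<^sup>2)
          * (norm (1 - cnj (v n) * z))\<^sup>2 * (1 - (norm (g z))\<^sup>2)" for n
      using schwarz_pick[OF v[of n] z] vpos[of n] by (simp add: field_simps)
    ultimately have "(norm (1 - cnj \<eta> * g z))\<^sup>2 * (1 - (norm z)\<^sup>2)
        \<le> b * (norm (1 - cnj \<sigma> * z))\<^sup>2 * (1 - (norm (g z))\<^sup>2)"
      by (blast intro: LIMSEQ_le)
    then show ?thesis by (simp add: rot n\<eta> n\<sigma>)
  qed
  then show ?thesis using that n\<eta> by simp
qed

end

section \<open>How the boundary dilation changes under the difference quotient\<close>

context disc_self_map
begin

text \<open>Julia's inequality bounds \<open>norm (\<eta> - g z)\<^sup>2\<close> by \<open>b * norm (\<sigma> - z)\<^sup>2\<close> times the squared dilation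
quotient. Inside a Stolz region, \<open>norm (\<sigma> - z)\<^sup>2 / (1 - norm z)\<close> is at most \<open>M * norm (\<sigma> - z)\<close>, which
gives the nontangential limit. The second part covers sequences that may approach the boundary
tangentially: a bounded dilation quotient still forces \<open>g z\<close> to the same limit. Sequences that
attain the dilation are of this kind.\<close>

lemma boundary_value:
  assumes \<sigma>: "\<sigma> \<in> unit_circle" and b: "boundary_dilation g \<sigma> = ereal b"
  shows nontangential_limit_unimodular: "norm (nontangential_limit g \<sigma>) = 1"
    and tendsto_nontangential_limit: "\<And>z C. \<lbrakk>\<And>n. z n \<in> unit_disc; z \<longlonglongrightarrow> \<sigma>;
        \<And>n. (1 - (norm (g (z n)))\<^sup>2) / (1 - (norm (z n))\<^sup>2) \<le> C\<rbrakk>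
      \<Longrightarrow> (\<lambda>n. g (z n)) \<longlonglongrightarrow> nontangential_limit g \<sigma>"
proof -
  obtain \<eta> where \<eta>: "\<eta> \<in> unit_circle"
    and julia: "\<And>z. z \<in> unit_disc \<Longrightarrow>
      (norm (\<eta> - g z))\<^sup>2 * (1 - (norm z)\<^sup>2) \<le> b * (norm (\<sigma> - z))\<^sup>2 * (1 - (norm (g z))\<^sup>2)"
    using julia_inequality[OF assms] by blast
  have b0: "b \<ge> 0"
    using dilation_pos[OF \<sigma>] b by simp
  have dpos: "1 - (norm z)\<^sup>2 > 0" if "z \<in> unit_disc" for z :: complex
    using that by (simp add: abs_square_less_1)
  have sqrt_bound: "norm (g z - \<eta>) \<le> sqrt R" if "(norm (\<eta> - g z))\<^sup>2 \<le> R" for z R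
    using that by (metis norm_ge_zero norm_minus_commute real_le_rsqrt)
  have "has_nontangential_limit g \<sigma> \<eta>"
    unfolding has_nontangential_limit_def
  proof (intro allI impI)
    fix M :: real assume M: "M > 1"
    have bound: "norm (g z - \<eta>) \<le> sqrt (b * M * norm (\<sigma> - z))" if "z \<in> stolz_region \<sigma> M" for z
    proof (rule sqrt_bound)
      have z: "z \<in> unit_disc" and zM: "norm (\<sigma> - z) < M * (1 - norm z)"
        using that by (auto simp: stolz_region_def)
      have "norm z * norm z \<le> norm z"
        using z by (simp add: mult_left_le)
      then have "M * (1 - norm z) \<le> M * (1 - (norm z)\<^sup>2)"
        using M by (simp add: power2_eq_square)
      then have zM': "norm (\<sigma> - z) \<le> M * (1 - (norm z)\<^sup>2)"
        using zM by simp
      have "(norm (\<eta> - g z))\<^sup>2 * (1 - (norm z)\<^sup>2) \<le> b * (norm (\<sigma> - z))\<^sup>2 * 1"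
        using b0 by (intro order.trans[OF julia[OF z]] mult_left_mono) auto
      also have "\<dots> \<le> b * norm (\<sigma> - z) * (M * (1 - (norm z)\<^sup>2))"
        using zM' b0 by (simp add: power2_eq_square mult.assoc mult_left_mono)
      finally have "(norm (\<eta> - g z))\<^sup>2 * (1 - (norm z)\<^sup>2) \<le> (b * M * norm (\<sigma> - z)) * (1 - (norm z)\<^sup>2)"
        by (simp add: mult_ac)
      then show "(norm (\<eta> - g z))\<^sup>2 \<le> b * M * norm (\<sigma> - z)"
        using dpos[OF z] by simp
    qed
    have "((\<lambda>z. sqrt (b * M * norm (\<sigma> - z))) \<longlongrightarrow> sqrt (b * M * norm (\<sigma> - \<sigma>))) (at \<sigma> within stolz_region \<sigma> M)"
      by (intro tendsto_intros)
    then have lim0: "((\<lambda>z. sqrt (b * M * norm (\<sigma> - z))) \<longlongrightarrow> 0) (at \<sigma> within stolz_region \<sigma> M)"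
      by simp
    have "eventually (\<lambda>z. norm (g z - \<eta>) \<le> sqrt (b * M * norm (\<sigma> - z)))
        (at \<sigma> within stolz_region \<sigma> M)"
      using bound by (auto simp: eventually_at_filter)
    from Lim_null_comparison[OF this lim0]
    show "(g \<longlongrightarrow> \<eta>) (at \<sigma> within stolz_region \<sigma> M)"
      by (rule LIM_zero_cancel)
  qed
  then have eq: "nontangential_limit g \<sigma> = \<eta>"
    by (rule nontangential_limit_eqI[OF \<sigma>])
  show "norm (nontangential_limit g \<sigma>) = 1" using eq \<eta> by simp
  fix z C
  assume z: "\<And>n. z n \<in> unit_disc" "z \<longlonglongrightarrow> \<sigma>"
    and C: "\<And>n. (1 - (norm (g (z n)))\<^sup>2) / (1 - (norm (z n))\<^sup>2) \<le> C"
  have bound: "norm (g (z n) - \<eta>) \<le> sqrt (b * (norm (\<sigma> - z n))\<^sup>2 * C)" for n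
  proof (rule sqrt_bound)
    have "(norm (\<eta> - g (z n)))\<^sup>2 \<le> b * (norm (\<sigma> - z n))\<^sup>2 * ((1 - (norm (g (z n)))\<^sup>2) / (1 - (norm (z n))\<^sup>2))"
      using julia[OF z(1)[of n]] dpos[OF z(1)[of n]] by (simp add: field_simps)
    also have "\<dots> \<le> b * (norm (\<sigma> - z n))\<^sup>2 * C"
      using C b0 by (intro mult_left_mono) auto
    finally show "(norm (\<eta> - g (z n)))\<^sup>2 \<le> b * (norm (\<sigma> - z n))\<^sup>2 * C" .
  qed
  have "(\<lambda>n. sqrt (b * (norm (\<sigma> - z n))\<^sup>2 * C)) \<longlonglongrightarrow> sqrt (b * (norm (\<sigma> - \<sigma>))\<^sup>2 * C)"
    by (intro tendsto_intros z)
  then have lim0: "(\<lambda>n. sqrt (b * (norm (\<sigma> - z n))\<^sup>2 * C)) \<longlonglongrightarrow> 0" by simp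
  have "(\<lambda>n. g (z n) - \<eta>) \<longlonglongrightarrow> 0"
    by (rule Lim_null_comparison[OF always_eventually lim0]) (use bound in simp)
  then show "(\<lambda>n. g (z n)) \<longlonglongrightarrow> nontangential_limit g \<sigma>"
    unfolding eq by (rule LIM_zero_cancel)
qed

text \<open>The chain rule for the dilation. With \<open>a = g 0\<close> and $h$ the difference quotient, the Moebius
identity turns \<open>(g z - a) / (1 - cnj a * g z) = z * h z\<close> into
\<open>(1 - \<bar>a\<bar>\<^sup>2) Q\<^sub>g = \<bar>1 - cnj a * g z\<bar>\<^sup>2 (1 + \<bar>z\<bar>\<^sup>2 Q\<^sub>h)\<close> for the squared dilation quotients. Along a
sequence that attains either dilation, \<open>Q\<^sub>g\<close> stays bounded, so \<open>g z\<close> tends to the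
boundary value and the identity passes to the limit. One sequence gives each inequality.\<close>

lemma boundary_dilation_hyp_diff_quot_0:
  assumes \<sigma>: "\<sigma> \<in> unit_circle" and b: "boundary_dilation g \<sigma> = ereal b"
  obtains b' where "boundary_dilation (hyp_diff_quot 0 g) \<sigma> = ereal b'" "b' \<ge> 0"
    "b = (1 + b') * ((norm (1 - cnj (g 0) * nontangential_limit g \<sigma>))\<^sup>2 / (1 - (norm (g 0))\<^sup>2))"
proof -
  define h where "h = hyp_diff_quot 0 g"
  define \<eta> where "\<eta> = nontangential_limit g \<sigma>"
  define a where "a = g 0"
  define K where "K = (norm (1 - cnj a * \<eta>))\<^sup>2 / (1 - (norm a)\<^sup>2)"
  have n\<sigma>: "norm \<sigma> = 1" using \<sigma> by simp
  have a: "norm a < 1" unfolding a_def by (rule norm_lt_1) simp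
  then have a2: "1 - (norm a)\<^sup>2 > 0" by (simp add: abs_square_less_1)
  have dpos: "1 - (norm z)\<^sup>2 > 0" if "z \<in> unit_disc" for z :: complex
    using that by (simp add: abs_square_less_1)
  have n\<eta>: "norm \<eta> = 1"
    unfolding \<eta>_def by (rule nontangential_limit_unimodular[OF assms])
  have ne\<eta>: "1 - cnj a * \<eta> \<noteq> 0"
    using one_minus_cnj_mult_nonzero[of a \<eta>] a n\<eta> by simp
  then have K: "K > 0" using a2 by (simp add: K_def)
  have nez: "norm (1 - cnj a * g z) > 0" if "z \<in> unit_disc" for z
    using one_minus_cnj_mult_nonzero[of a "g z"] a norm_lt_1[OF that] by simp
  define Qg Qh where "Qg z = (1 - (norm (g z))\<^sup>2) / (1 - (norm z)\<^sup>2)"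
    and "Qh z = (1 - (norm (h z))\<^sup>2) / (1 - (norm z)\<^sup>2)" for z
  have key: "(1 - (norm a)\<^sup>2) * Qg z = (norm (1 - cnj a * g z))\<^sup>2 * (1 + (norm z)\<^sup>2 * Qh z)"
    if z: "z \<in> unit_disc" for z
  proof -
    have "g z - a = z * h z * (1 - cnj a * g z)"
      using hyp_diff_quot_0_factor[OF z] nez[OF z]
      by (simp add: Moebius_function_simple h_def a_def field_simps)
    then have "(norm (g z - a))\<^sup>2 = (norm z)\<^sup>2 * (norm (h z))\<^sup>2 * (norm (1 - cnj a * g z))\<^sup>2"
      by (simp add: norm_mult power_mult_distrib)
    then have "(1 - (norm a)\<^sup>2) * (1 - (norm (g z))\<^sup>2)
        = (norm (1 - cnj a * g z))\<^sup>2 * (1 - (norm z)\<^sup>2 * (norm (h z))\<^sup>2)"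
      using norm_moebius_identity[of a "g z"] by (simp add: algebra_simps)
    also have "1 - (norm z)\<^sup>2 * (norm (h z))\<^sup>2
        = (1 - (norm z)\<^sup>2) * (1 + (norm z)\<^sup>2 * Qh z)"
      using dpos[OF z] by (simp add: Qh_def field_simps)
    finally show ?thesis
      using dpos[OF z] by (simp add: Qg_def field_simps)
  qed
  have h_le: "norm (h z) \<le> 1" if "z \<in> unit_disc" for z
    unfolding h_def by (rule norm_hyp_diff_quot_0_le_1[OF that])
  have h_ge: "boundary_dilation h \<sigma> \<ge> 0"
    by (rule boundary_dilation_nonneg[OF h_le])
  have to_\<eta>: "(\<lambda>n. g (z n)) \<longlonglongrightarrow> \<eta>"
    if "\<And>n. z n \<in> unit_disc" "z \<longlonglongrightarrow> \<sigma>" "Bseq (\<lambda>n. Qg (z n))" for z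
  proof -
    from that(3) obtain C where "\<And>n. norm (Qg (z n)) \<le> C" unfolding Bseq_def by blast
    then have "Qg (z n) \<le> C" for n using abs_ge_self order.trans by (metis real_norm_def)
    then show ?thesis
      unfolding \<eta>_def Qg_def by (rule tendsto_nontangential_limit[OF assms that(1,2)])
  qed
  \<comment> \<open>A sequence attaining the dilation of $g$ bounds that of $h$ from above.\<close>
  obtain z where z: "\<And>n. z n \<in> unit_disc" "z \<longlonglongrightarrow> \<sigma>"
    and q: "(\<lambda>n. (1 - norm (g (z n))) / (1 - norm (z n))) \<longlonglongrightarrow> b"
    using boundary_dilation_attained[OF assms] by blast
  have Qgb: "(\<lambda>n. Qg (z n)) \<longlonglongrightarrow> b"
    using q dilation_quotient_tendsto_iff_squared[OF \<sigma> z] unfolding Qg_def by blast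
  then have g\<eta>: "(\<lambda>n. g (z n)) \<longlonglongrightarrow> \<eta>"
    by (intro to_\<eta> z convergent_imp_Bseq convergentI)
  have "(\<lambda>n. ((1 - (norm a)\<^sup>2) * Qg (z n) / (norm (1 - cnj a * g (z n)))\<^sup>2 - 1) / (norm (z n))\<^sup>2)
      \<longlonglongrightarrow> ((1 - (norm a)\<^sup>2) * b / (norm (1 - cnj a * \<eta>))\<^sup>2 - 1) / (norm \<sigma>)\<^sup>2"
    using ne\<eta> n\<sigma> by (intro tendsto_intros Qgb g\<eta> z) auto
  moreover have "eventually (\<lambda>n. ((1 - (norm a)\<^sup>2) * Qg (z n) / (norm (1 - cnj a * g (z n)))\<^sup>2 - 1)
      / (norm (z n))\<^sup>2 = Qh (z n)) sequentially"
  proof -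
    have "eventually (\<lambda>n. z n \<noteq> 0) sequentially"
      using z(2) n\<sigma> by (intro tendsto_imp_eventually_ne) auto
    then show ?thesis
      by eventually_elim (use key[OF z(1)] nez[OF z(1)] in simp)
  qed
  ultimately have "(\<lambda>n. Qh (z n)) \<longlonglongrightarrow> ((1 - (norm a)\<^sup>2) * b / (norm (1 - cnj a * \<eta>))\<^sup>2 - 1) / (norm \<sigma>)\<^sup>2"
    by (rule Lim_transform_eventually)
  then have "(\<lambda>n. Qh (z n)) \<longlonglongrightarrow> b / K - 1"
    by (simp add: K_def n\<sigma> mult.commute)
  then have "(\<lambda>n. (1 - norm (h (z n))) / (1 - norm (z n))) \<longlonglongrightarrow> b / K - 1"
    using dilation_quotient_tendsto_iff_squared[OF \<sigma> z] unfolding Qh_def by blast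
  then have h_upper: "boundary_dilation h \<sigma> \<le> ereal (b / K - 1)"
    by (rule boundary_dilation_le_of_sequence[OF \<sigma> z])
  obtain b' where b': "boundary_dilation h \<sigma> = ereal b'" "b' \<ge> 0"
    using h_upper h_ge by (cases "boundary_dilation h \<sigma>") auto
  have upper: "(1 + b') * K \<le> b"
    using h_upper b' K by (simp add: field_simps)
  \<comment> \<open>A sequence attaining the dilation of $h$ bounds that of $g$ from above.\<close>
  obtain y where y: "\<And>n. y n \<in> unit_disc" "y \<longlonglongrightarrow> \<sigma>"
    and qy: "(\<lambda>n. (1 - norm (h (y n))) / (1 - norm (y n))) \<longlonglongrightarrow> b'"
    using boundary_dilation_attained[OF \<sigma> b'(1)] by blast
  have Qhb: "(\<lambda>n. Qh (y n)) \<longlonglongrightarrow> b'"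
    using qy dilation_quotient_tendsto_iff_squared[OF \<sigma> y] unfolding Qh_def by blast
  have key': "Qg (y n) = (norm (1 - cnj a * g (y n)))\<^sup>2 * (1 + (norm (y n))\<^sup>2 * Qh (y n)) / (1 - (norm a)\<^sup>2)" for n
    using key[OF y(1)[of n]] a2 by (simp add: field_simps)
  \<comment> \<open>The constant 4 bounds \<open>norm (1 - cnj a * g z)\<^sup>2\<close>; convergence of \<open>g (y n)\<close> is not known yet.\<close>
  have "(\<lambda>n. 4 * (1 + (norm (y n))\<^sup>2 * Qh (y n)) / (1 - (norm a)\<^sup>2)) \<longlonglongrightarrow>
      4 * (1 + (norm \<sigma>)\<^sup>2 * b') / (1 - (norm a)\<^sup>2)"
    using a2 by (intro tendsto_intros y Qhb) auto
  then have major: "Bseq (\<lambda>n. 4 * (1 + (norm (y n))\<^sup>2 * Qh (y n)) / (1 - (norm a)\<^sup>2))"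
    by (intro convergent_imp_Bseq convergentI)
  have dom: "norm (Qg (y n)) \<le> norm (4 * (1 + (norm (y n))\<^sup>2 * Qh (y n)) / (1 - (norm a)\<^sup>2))" for n
  proof -
    have "norm (1 - cnj a * g (y n)) \<le> 1 + norm a * norm (g (y n))"
      using norm_triangle_ineq4[of 1 "cnj a * g (y n)"] by (simp add: norm_mult)
    also have "\<dots> \<le> 1 + 1 * 1"
      using a norm_lt_1[OF y(1)[of n]] by (intro add_left_mono mult_mono) auto
    finally have "(norm (1 - cnj a * g (y n)))\<^sup>2 \<le> 2\<^sup>2"
      by (intro power_mono) auto
    then have 4: "(norm (1 - cnj a * g (y n)))\<^sup>2 \<le> 4" by simp
    have "(norm (h (y n)))\<^sup>2 \<le> 1" using h_le[OF y(1)[of n]] by (simp add: power_le_one)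
    then have "Qh (y n) \<ge> 0" using dpos[OF y(1)[of n]] by (simp add: Qh_def)
    then have 0: "1 + (norm (y n))\<^sup>2 * Qh (y n) \<ge> 0" by simp
    have "(norm (1 - cnj a * g (y n)))\<^sup>2 * (1 + (norm (y n))\<^sup>2 * Qh (y n)) / (1 - (norm a)\<^sup>2)
        \<le> 4 * (1 + (norm (y n))\<^sup>2 * Qh (y n)) / (1 - (norm a)\<^sup>2)"
      using 4 0 a2 by (intro divide_right_mono mult_right_mono) auto
    moreover have "(norm (1 - cnj a * g (y n)))\<^sup>2 * (1 + (norm (y n))\<^sup>2 * Qh (y n)) / (1 - (norm a)\<^sup>2) \<ge> 0"
      using 0 a2 by (intro divide_nonneg_pos mult_nonneg_nonneg) auto
    ultimately show ?thesis
      unfolding key' real_norm_def by linarith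
  qed
  have "Bseq (\<lambda>n. Qg (y n))"
    by (rule Bseq_eventually_mono[OF always_eventually[OF allI[OF dom]] major])
  then have g\<eta>': "(\<lambda>n. g (y n)) \<longlonglongrightarrow> \<eta>" by (rule to_\<eta>[OF y])
  have "(\<lambda>n. Qg (y n)) \<longlonglongrightarrow> (norm (1 - cnj a * \<eta>))\<^sup>2 * (1 + (norm \<sigma>)\<^sup>2 * b') / (1 - (norm a)\<^sup>2)"
    unfolding key' using a2 by (intro tendsto_intros y Qhb g\<eta>') auto
  then have "(\<lambda>n. Qg (y n)) \<longlonglongrightarrow> (1 + b') * K"
    by (simp add: K_def n\<sigma> mult.commute)
  then have "(\<lambda>n. (1 - norm (g (y n))) / (1 - norm (y n))) \<longlonglongrightarrow> (1 + b') * K"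
    using dilation_quotient_tendsto_iff_squared[OF \<sigma> y] unfolding Qg_def by blast
  then have "boundary_dilation g \<sigma> \<le> ereal ((1 + b') * K)"
    by (rule boundary_dilation_le_of_sequence[OF \<sigma> y])
  then have "b \<le> (1 + b') * K" using b by simp
  then have "b = (1 + b') * K" using upper by simp
  then show ?thesis
    using that b' unfolding h_def K_def a_def \<eta>_def by blast
qed

end

lemma boundary_dilation_unimodular_constant:
  assumes "\<sigma> \<in> unit_circle" "blaschke_product 0 g"
  shows "boundary_dilation g \<sigma> = 0"
proof (rule antisym)
  obtain c where c: "norm c = 1" "\<And>z. z \<in> unit_disc \<Longrightarrow> g z = c"
    using assms(2) by (auto simp: blaschke_product_0_iff)
  show "0 \<le> boundary_dilation g \<sigma>"
    by (rule boundary_dilation_nonneg) (use c in simp)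
  have "boundary_dilation g \<sigma> = Liminf (at \<sigma> within unit_disc) (\<lambda>z. 0)"
    unfolding boundary_dilation_def
    by (rule Liminf_eq) (use c in \<open>auto simp: eventually_at_filter zero_ereal_def\<close>)
  moreover have "at \<sigma> within unit_disc \<noteq> bot"
    using assms(1) by (simp add: trivial_limit_within islimpt_ball)
  ultimately show "boundary_dilation g \<sigma> \<le> 0"
    by (simp add: Liminf_const)
qed

text \<open>This is \<open>norm (1 - u) \<ge> 1 - norm u\<close> for \<open>u = cnj a * \<eta>\<close>, where equality means that $u$ is real and
nonnegative.\<close>

lemma dilation_factor_ge:
  fixes a \<eta> :: complex
  assumes "norm a < 1" "norm \<eta> = 1"
  shows "(1 - norm a) / (1 + norm a) \<le> (norm (1 - cnj a * \<eta>))\<^sup>2 / (1 - (norm a)\<^sup>2)"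
    and "(1 - norm a) / (1 + norm a) = (norm (1 - cnj a * \<eta>))\<^sup>2 / (1 - (norm a)\<^sup>2)
      \<longleftrightarrow> a = of_real (norm a) * \<eta>"
proof -
  define u where "u = cnj a * \<eta>"
  have nu: "norm u = norm a" using assms by (simp add: u_def norm_mult)
  have r: "(1 - norm a) / (1 + norm a) = (1 - norm a)\<^sup>2 / (1 - (norm a)\<^sup>2)"
  proof -
    have "1 - (norm a)\<^sup>2 = (1 - norm a) * (1 + norm a)"
      by (simp add: power2_eq_square algebra_simps)
    then show ?thesis using assms by (simp add: power2_eq_square)
  qed
  have pos: "1 - (norm a)\<^sup>2 > 0" using assms by (simp add: abs_square_less_1)
  have sq: "(norm (1 - u))\<^sup>2 = (1 - norm a)\<^sup>2 + 2 * (norm a - Re u)"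
  proof -
    have "(norm (1 - u))\<^sup>2 = 1 - 2 * Re u + (norm u)\<^sup>2"
      unfolding cmod_power2 by (simp add: power2_eq_square algebra_simps)
    then show ?thesis unfolding nu by (simp add: power2_eq_square algebra_simps)
  qed
  have Re: "Re u \<le> norm a" using complex_Re_le_cmod[of u] nu by simp
  show "(1 - norm a) / (1 + norm a) \<le> (norm (1 - cnj a * \<eta>))\<^sup>2 / (1 - (norm a)\<^sup>2)"
    unfolding r u_def[symmetric] sq using Re pos by (intro divide_right_mono) auto
  have "(1 - norm a) / (1 + norm a) = (norm (1 - cnj a * \<eta>))\<^sup>2 / (1 - (norm a)\<^sup>2) \<longleftrightarrow> Re u = norm a"
    unfolding r u_def[symmetric] sq using pos by auto
  also have "\<dots> \<longleftrightarrow> u = of_real (norm a)"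
  proof
    assume Ru: "Re u = norm a"
    then have "Im u = 0"
      using nu cmod_power2[of u] by simp
    then show "u = of_real (norm a)" using Ru by (simp add: complex_eq_iff)
  qed simp
  also have "\<dots> \<longleftrightarrow> a = of_real (norm a) * \<eta>"
  proof -
    have \<eta>\<eta>: "\<eta> * cnj \<eta> = 1" using assms complex_norm_square[of \<eta>] by simp
    have "a = cnj u * \<eta>" using \<eta>\<eta> by (simp add: u_def mult.assoc mult.commute[of "cnj \<eta>"])
    moreover have "\<eta> \<noteq> 0" using assms by auto
    moreover have "cnj u = of_real (norm a) \<longleftrightarrow> u = of_real (norm a)"
      by (metis complex_cnj_cnj complex_cnj_complex_of_real)
    ultimately show ?thesis by (metis mult_cancel_right)
  qed
  finally show "(1 - norm a) / (1 + norm a) = (norm (1 - cnj a * \<eta>))\<^sup>2 / (1 - (norm a)\<^sup>2)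
      \<longleftrightarrow> a = of_real (norm a) * \<eta>" .
qed

section \<open>Iteration\<close>

text \<open>If the sums agree, so do all partial products, and the factors are recovered as quotients of
consecutive partial products.\<close>

lemma sum_prod_mono_and_eq_iff:
  fixes r q :: "nat \<Rightarrow> real"
  assumes "\<And>h. h \<le> k \<Longrightarrow> 0 < r h" "\<And>h. h \<le> k \<Longrightarrow> r h \<le> q h"
  shows "(\<Sum>j=0..k. \<Prod>h=0..j. r h) \<le> (\<Sum>j=0..k. \<Prod>h=0..j. q h)"
    and "(\<Sum>j=0..k. \<Prod>h=0..j. r h) = (\<Sum>j=0..k. \<Prod>h=0..j. q h) \<longleftrightarrow> (\<forall>h\<in>{0..k}. r h = q h)"
proof -
  have le: "(\<Prod>h=0..j. r h) \<le> (\<Prod>h=0..j. q h)" if "j \<in> {0..k}" for j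
    using assms that by (intro prod_mono) (auto intro: less_imp_le)
  then show "(\<Sum>j=0..k. \<Prod>h=0..j. r h) \<le> (\<Sum>j=0..k. \<Prod>h=0..j. q h)"
    by (intro sum_mono)
  show "(\<Sum>j=0..k. \<Prod>h=0..j. r h) = (\<Sum>j=0..k. \<Prod>h=0..j. q h) \<longleftrightarrow> (\<forall>h\<in>{0..k}. r h = q h)"
  proof
    assume eq: "(\<Sum>j=0..k. \<Prod>h=0..j. r h) = (\<Sum>j=0..k. \<Prod>h=0..j. q h)"
    have prods: "(\<Prod>h=0..j. r h) = (\<Prod>h=0..j. q h)" if "j \<le> k" for j
      using sum_mono_inv[OF eq le] that by simp
    show "\<forall>h\<in>{0..k}. r h = q h"
    proof
      fix h assume h: "h \<in> {0..k}"
      show "r h = q h"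
      proof (cases h)
        case 0
        then show ?thesis using prods[of 0] by simp
      next
        case (Suc i)
        have "(\<Prod>h=0..i. r h) > 0" using assms(1) h Suc by (intro prod_pos) auto
        moreover have "(\<Prod>h=0..i. r h) * r h = (\<Prod>h=0..i. r h) * q h"
          using prods[of i] prods[of h] h Suc by simp
        ultimately show ?thesis by (metis less_irrefl mult_left_cancel)
      qed
    qed
  next
    assume "\<forall>h\<in>{0..k}. r h = q h"
    then show "(\<Sum>j=0..k. \<Prod>h=0..j. r h) = (\<Sum>j=0..k. \<Prod>h=0..j. q h)"
      by (intro sum.cong prod.cong) auto
  qed
qed

lemma unfold_affine_recursion:
  fixes b q :: "nat \<Rightarrow> real"
  assumes "\<And>h. h \<le> k \<Longrightarrow> b h = (1 + b (Suc h)) * q h"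
  shows "b 0 = (\<Sum>j=0..k. \<Prod>h=0..j. q h) + (\<Prod>h=0..k. q h) * b (Suc k)"
  using assms
proof (induction k)
  case 0
  then show ?case by (simp add: algebra_simps)
next
  case (Suc k)
  have "b 0 = (\<Sum>j=0..k. \<Prod>h=0..j. q h) + (\<Prod>h=0..k. q h) * b (Suc k)"
    using Suc by simp
  also have "b (Suc k) = (1 + b (Suc (Suc k))) * q (Suc k)"
    using Suc.prems by blast
  finally show ?case by (simp add: algebra_simps)
qed

lemma blaschke_product_of_iterate:
  assumes "\<And>i. i < h \<Longrightarrow> disc_self_map (hyp_diff_quot_zeros i f)"
  shows "blaschke_product (d + h) f \<longleftrightarrow> blaschke_product d (hyp_diff_quot_zeros h f)"
  using assms
proof (induction h arbitrary: d)
  case (Suc h)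
  then have "blaschke_product (Suc d + h) f \<longleftrightarrow> blaschke_product (Suc d) (hyp_diff_quot_zeros h f)"
    by (metis less_SucI)
  also have "\<dots> \<longleftrightarrow> blaschke_product d (hyp_diff_quot_zeros (Suc h) f)"
    using disc_self_map.blaschke_product_Suc_iff[of "hyp_diff_quot_zeros h f" d] Suc.prems by simp
  finally show ?case by simp
qed simp

text \<open>The first iterate that fails to map the disc into itself would be a unimodular constant, and
$f$ would be a Blaschke product of the degree given by its index.\<close>

lemma hyp_diff_quot_zeros_self_map:
  assumes "disc_self_map f" "\<not> (\<exists>d\<le>k. blaschke_product d f)" "h \<le> k"
  shows "disc_self_map (hyp_diff_quot_zeros h f)"
  using assms(3)
proof (induction h rule: less_induct)
  case (less h)
  show ?case
  proof (cases h)
    case (Suc i)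
    interpret disc_self_map "hyp_diff_quot_zeros i f"
      using less Suc by simp
    have "\<not> blaschke_product 0 (hyp_diff_quot_zeros h f)"
      using blaschke_product_of_iterate[of h f 0] less assms(2) by auto
    then have "hyp_diff_quot_zeros h f ` unit_disc \<subseteq> unit_disc"
      using hyp_diff_quot_0_self_map_or_constant Suc by simp
    then show ?thesis
      using hyp_diff_quot_0_holomorphic Suc by (simp add: disc_self_map_def)
  qed (use assms(1) in simp)
qed

theorem corollary1p7:
  fixes k :: nat and f :: "complex \<Rightarrow> complex" and \<sigma> :: complex
  assumes "f holomorphic_on unit_disc"
    and "f ` unit_disc \<subseteq> unit_disc"
    and "\<not> (\<exists>d\<le>k. blaschke_product d f)"
    and "\<sigma> \<in> unit_circle"
    and "boundary_dilation f \<sigma> < \<infinity>"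
  shows "boundary_dilation f \<sigma> \<ge>
      ereal (\<Sum>j=0..k. \<Prod>h=0..j.
        (1 - norm (hyp_diff_quot_zeros h f 0)) / (1 + norm (hyp_diff_quot_zeros h f 0)))
    \<and> (boundary_dilation f \<sigma> =
        ereal (\<Sum>j=0..k. \<Prod>h=0..j.
          (1 - norm (hyp_diff_quot_zeros h f 0)) / (1 + norm (hyp_diff_quot_zeros h f 0)))
      \<longleftrightarrow>
        blaschke_product (k + 1) f \<and>
        (\<forall>h\<in>{0..k}. hyp_diff_quot_zeros h f 0 =
          of_real (norm (hyp_diff_quot_zeros h f 0)) *
          nontangential_limit (hyp_diff_quot_zeros h f) \<sigma>))"
proof -
  note \<sigma> = \<open>\<sigma> \<in> unit_circle\<close>
  define D where "D h = hyp_diff_quot_zeros h f" for h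
  define \<eta> where "\<eta> h = nontangential_limit (D h) \<sigma>" for h
  define r where "r h = (1 - norm (D h 0)) / (1 + norm (D h 0))" for h
  define q where "q h = (norm (1 - cnj (D h 0) * \<eta> h))\<^sup>2 / (1 - (norm (D h 0))\<^sup>2)" for h
  define b where "b h = real_of_ereal (boundary_dilation (D h) \<sigma>)" for h
  have "disc_self_map f" using assms(1,2) by (simp add: disc_self_map_def)
  then have self: "disc_self_map (D h)" if "h \<le> k" for h
    unfolding D_def using assms(3) that by (rule hyp_diff_quot_zeros_self_map)
  have D_Suc: "D (Suc h) = hyp_diff_quot 0 (D h)" for h
    by (simp add: D_def)
  have step: "\<exists>b'. boundary_dilation (D (Suc h)) \<sigma> = ereal b' \<and> 0 \<le> b' \<and> c = (1 + b') * q h"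
    if "h \<le> k" "boundary_dilation (D h) \<sigma> = ereal c" for h c
    unfolding D_Suc q_def \<eta>_def
    by (rule disc_self_map.boundary_dilation_hyp_diff_quot_0[OF self[OF that(1)] \<sigma> that(2)]) blast
  have fin: "boundary_dilation (D h) \<sigma> = ereal (b h)" if "h \<le> Suc k" for h
    using that
  proof (induction h)
    case 0
    have "boundary_dilation f \<sigma> > 0"
      using disc_self_map.dilation_pos[OF \<open>disc_self_map f\<close> \<sigma>] .
    then show ?case
      using assms(5) by (cases "boundary_dilation f \<sigma>") (auto simp: b_def D_def)
  next
    case (Suc h)
    then show ?case using step[of h "b h"] by (auto simp: b_def)
  qed
  have rec: "b h = (1 + b (Suc h)) * q h" and b_nonneg: "0 \<le> b (Suc h)" if "h \<le> k" for h
    using step[OF that fin] fin[of "Suc h"] that by auto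
  have b0: "b 0 = (\<Sum>j=0..k. \<Prod>h=0..j. q h) + (\<Prod>h=0..k. q h) * b (Suc k)"
    by (rule unfold_affine_recursion[of k b q]) (rule rec)
  have D0: "norm (D h 0) < 1" if "h \<le> k" for h
    by (rule disc_self_map.norm_lt_1[OF self[OF that]]) simp
  have \<eta>: "norm (\<eta> h) = 1" if "h \<le> k" for h
    unfolding \<eta>_def using that
    by (intro disc_self_map.nontangential_limit_unimodular[OF self \<sigma> fin]) auto
  have r_pos: "0 < r h" if "h \<le> k" for h
    using D0[OF that] by (auto simp: r_def intro!: divide_pos_pos add_pos_nonneg)
  have r_le: "r h \<le> q h" and r_eq: "r h = q h \<longleftrightarrow> D h 0 = of_real (norm (D h 0)) * \<eta> h"
    if "h \<le> k" for h
    unfolding r_def q_def using dilation_factor_ge[OF D0 \<eta>] that by auto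
  have sums: "(\<Sum>j=0..k. \<Prod>h=0..j. r h) \<le> (\<Sum>j=0..k. \<Prod>h=0..j. q h)"
    "(\<Sum>j=0..k. \<Prod>h=0..j. r h) = (\<Sum>j=0..k. \<Prod>h=0..j. q h) \<longleftrightarrow> (\<forall>h\<in>{0..k}. r h = q h)"
    using sum_prod_mono_and_eq_iff[of k r q] r_pos r_le by auto
  have q_pos: "0 < (\<Prod>h=0..k. q h)"
    using r_pos r_le by (intro prod_pos) (auto intro: less_le_trans)
  have last: "b (Suc k) = 0 \<longleftrightarrow> blaschke_product (k + 1) f"
  proof -
    have iff: "blaschke_product (k + 1) f \<longleftrightarrow> blaschke_product 0 (D (Suc k))"
      using blaschke_product_of_iterate[of "Suc k" f 0] self by (simp add: D_def less_Suc_eq_le)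
    interpret disc_self_map "D k" using self by simp
    have "b (Suc k) > 0" if "\<not> blaschke_product 0 (D (Suc k))"
    proof -
      have "disc_self_map (D (Suc k))"
        using that hyp_diff_quot_0_self_map_or_constant hyp_diff_quot_0_holomorphic
        by (simp add: disc_self_map_def D_Suc)
      from disc_self_map.dilation_pos[OF this \<sigma>] show ?thesis by (simp add: fin)
    qed
    moreover have "b (Suc k) = 0" if "blaschke_product 0 (D (Suc k))"
      using boundary_dilation_unimodular_constant[OF \<sigma> that] by (simp add: b_def)
    ultimately show ?thesis using iff by force
  qed
  have tail: "0 \<le> (\<Prod>h=0..k. q h) * b (Suc k)"
    using q_pos b_nonneg[of k] by simp
  have bound: "(\<Sum>j=0..k. \<Prod>h=0..j. r h) \<le> b 0"
    using b0 sums(1) tail by simp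
  have tail_0: "(\<Prod>h=0..k. q h) * b (Suc k) = 0 \<longleftrightarrow> b (Suc k) = 0"
    using less_imp_neq[OF q_pos] mult_eq_0_iff by metis
  have "b 0 = (\<Sum>j=0..k. \<Prod>h=0..j. r h) \<longleftrightarrow>
      (\<Sum>j=0..k. \<Prod>h=0..j. r h) = (\<Sum>j=0..k. \<Prod>h=0..j. q h) \<and> (\<Prod>h=0..k. q h) * b (Suc k) = 0"
    using b0 sums(1) tail by linarith
  also have "\<dots> \<longleftrightarrow>
      blaschke_product (k + 1) f \<and> (\<forall>h\<in>{0..k}. D h 0 = of_real (norm (D h 0)) * \<eta> h)"
    unfolding sums(2) tail_0 last using r_eq by auto
  finally have equality: "b 0 = (\<Sum>j=0..k. \<Prod>h=0..j. r h) \<longleftrightarrow>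
      blaschke_product (k + 1) f \<and> (\<forall>h\<in>{0..k}. D h 0 = of_real (norm (D h 0)) * \<eta> h)" .
  have "boundary_dilation f \<sigma> = ereal (b 0)"
    using fin[of 0] by (simp add: D_def)
  then show ?thesis
    using bound equality unfolding r_def D_def \<eta>_def by simp
qed

end
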